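(* There exists a strongly aperiodic tileset on the lamplighter group consisting of $1488$ tetrahedra: there are a finite set $C$ and a set $\Delta\subseteq C^4$ of cardinality $1488$ such that the SFT $X_\Delta$ on the lamplighter group $\mathcal L$ is non-empty and $\mathcal L$ acts freely on it (every $x\in X_\Delta$ has trivial stabilizer).
   Context: Lamplighter group: let $\mathbb E=\mathbb Z+\frac12$. Elements of $\mathcal L=(\mathbb Z/2)\wr\mathbb Z$ are pairs $(s,n)$ with $s\colon\mathbb E\to\mathbb Z/2$ finitely supported and $n\in\mathbb Z$, with product $(t,m)(s,n)=(s+t(\cdot-n),\,m+n)$; generators are $a=(0,1)$ and $b=(\delta_{1/2},1)$, with $\delta_{1/2}$ the indicator of $\frac12$. $\mathcal L$ acts on $C^{\mathcal L}$ by $(gx)(h)=x(hg)$. A tetrahedron is a tuple $(c_1,c_2,c_3,c_4)\in C^4$, prescribing colours at the vertices $v,\ av,\ b^{-1}av,\ bv$ in that order. Since the same four vertices are seen from $b^{-1}av$ in the order $(c_3,c_4,c_1,c_2)$, a set of tetrahedra is implicitly completed under this switch: with $\hat\Delta=\Delta\cup\{(c_3,c_4,c_1,c_2):(c_1,c_2,c_3,c_4)\in\Delta\}$, $$X_\Delta=\{x\colon\mathcal L\to C \mid (x(v),x(av),x(b^{-1}av),x(bv))\in\hat\Delta\ \text{ for all } v\in\mathcal L\}.$$ *)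

theory Defs
  imports Complex_Main "HOL-Algebra.Group_Action" "HOL-Library.Z2"
begin

definition half_integers :: "rat set"
  where "half_integers = range (\<lambda>k::int. of_int k + 1/2)"

text \<open>
  A finitely supported function from the half-integers to \<open>Z/2\<close> is encoded as the function on
  the rationals that extends it by \<open>0\<close>.
\<close>

definition lamp_configs :: "(rat \<Rightarrow> bit) set"
  where "lamp_configs = {s. {e. s e \<noteq> 0} \<subseteq> half_integers \<and> finite {e. s e \<noteq> 0}}"

type_synonym lamp = "(rat \<Rightarrow> bit) \<times> int"

definition lamplighter :: "lamp monoid"
  where "lamplighter =
    \<lparr>carrier = lamp_configs \<times> UNIV,
     mult = (\<lambda>(t, m) (s, n). (\<lambda>e. s e + t (e - of_int n), m + n)),
     one = (\<lambda>_. 0, 0)\<rparr>"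

definition gen_a :: lamp
  where "gen_a = (\<lambda>_. 0, 1)"

definition gen_b :: lamp
  where "gen_b = (\<lambda>e. if e = 1/2 then 1 else 0, 1)"

definition colourings :: "'c set \<Rightarrow> (lamp \<Rightarrow> 'c) set"
  where "colourings C = carrier lamplighter \<rightarrow>\<^sub>E C"

definition shift :: "'c set \<Rightarrow> lamp \<Rightarrow> (lamp \<Rightarrow> 'c) \<Rightarrow> (lamp \<Rightarrow> 'c)"
  where "shift C g =
    (\<lambda>x\<in>colourings C. \<lambda>h\<in>carrier lamplighter. x (h \<otimes>\<^bsub>lamplighter\<^esub> g))"

type_synonym 'c tetrahedron = "'c \<times> 'c \<times> 'c \<times> 'c"

definition completion :: "'c tetrahedron set \<Rightarrow> 'c tetrahedron set"
  where "completion \<Delta> = \<Delta> \<union> {(c3, c4, c1, c2) | c1 c2 c3 c4. (c1, c2, c3, c4) \<in> \<Delta>}"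

definition tetra_SFT :: "'c set \<Rightarrow> 'c tetrahedron set \<Rightarrow> (lamp \<Rightarrow> 'c) set"
  where "tetra_SFT C \<Delta> = {x \<in> colourings C. \<forall>v \<in> carrier lamplighter.
    (x v,
     x (gen_a \<otimes>\<^bsub>lamplighter\<^esub> v),
     x (inv\<^bsub>lamplighter\<^esub> gen_b \<otimes>\<^bsub>lamplighter\<^esub> gen_a \<otimes>\<^bsub>lamplighter\<^esub> v),
     x (gen_b \<otimes>\<^bsub>lamplighter\<^esub> v)) \<in> completion \<Delta>}"

lemma half_integers_shift: "e - of_int n \<in> half_integers \<longleftrightarrow> e \<in> half_integers"
proof
  assume "e - of_int n \<in> half_integers"
  then obtain k where "e - of_int n = of_int k + 1/2"
    by (auto simp: half_integers_def)
  then have "e = of_int (k + n) + 1/2" by (simp add: algebra_simps)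
  then show "e \<in> half_integers" unfolding half_integers_def by blast
next
  assume "e \<in> half_integers"
  then obtain k where "e = of_int k + 1/2"
    by (auto simp: half_integers_def)
  then have "e - of_int n = of_int (k - n) + 1/2" by (simp add: algebra_simps)
  then show "e - of_int n \<in> half_integers" unfolding half_integers_def by blast
qed

lemma lamp_configs_translate:
  assumes "s \<in> lamp_configs"
  shows "(\<lambda>e. s (e - of_int n)) \<in> lamp_configs"
proof -
  have "{e. s (e - of_int n) \<noteq> 0} = (\<lambda>e. e + of_int n) ` {e. s e \<noteq> 0}"
    by (auto simp: image_iff intro!: exI[of _ "_ - of_int n"])
  then have "finite {e. s (e - of_int n) \<noteq> 0}"
    using assms by (simp add: lamp_configs_def)
  moreover have "{e. s (e - of_int n) \<noteq> 0} \<subseteq> half_integers"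
    using assms half_integers_shift by (auto simp: lamp_configs_def)
  ultimately show ?thesis by (simp add: lamp_configs_def)
qed

lemma lamp_configs_add:
  assumes "s \<in> lamp_configs" "t \<in> lamp_configs"
  shows "(\<lambda>e. s e + t e) \<in> lamp_configs"
proof -
  have "{e. s e + t e \<noteq> 0} \<subseteq> {e. s e \<noteq> 0} \<union> {e. t e \<noteq> 0}" by auto
  then show ?thesis
    using assms unfolding lamp_configs_def mem_Collect_eq
    by (meson finite_Un finite_subset le_sup_iff order_trans)
qed

lemma group_lamplighter: "group lamplighter"
proof (rule groupI)
  fix x y assume "x \<in> carrier lamplighter" "y \<in> carrier lamplighter"
  then show "x \<otimes>\<^bsub>lamplighter\<^esub> y \<in> carrier lamplighter"
    by (auto simp: lamplighter_def simp del: add_bit_eq_xor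
        intro!: lamp_configs_add lamp_configs_translate)
next
  show "\<one>\<^bsub>lamplighter\<^esub> \<in> carrier lamplighter"
    by (simp add: lamplighter_def lamp_configs_def)
next
  fix x y z
  show "x \<otimes>\<^bsub>lamplighter\<^esub> y \<otimes>\<^bsub>lamplighter\<^esub> z = x \<otimes>\<^bsub>lamplighter\<^esub> (y \<otimes>\<^bsub>lamplighter\<^esub> z)"
    by (auto simp: lamplighter_def fun_eq_iff split_beta algebra_simps diff_diff_eq)
next
  fix x
  show "\<one>\<^bsub>lamplighter\<^esub> \<otimes>\<^bsub>lamplighter\<^esub> x = x"
    by (auto simp: lamplighter_def split_beta simp del: add_bit_eq_xor)
next
  fix x assume x: "x \<in> carrier lamplighter"
  obtain s n where sn: "x = (s, n)" by (cases x)
  let ?y = "(\<lambda>e. s (e - of_int (- n)), - n)"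
  have "?y \<in> carrier lamplighter"
    using x lamp_configs_translate[of s "- n"] by (auto simp: sn lamplighter_def)
  moreover have "?y \<otimes>\<^bsub>lamplighter\<^esub> x = \<one>\<^bsub>lamplighter\<^esub>"
    by (auto simp: sn lamplighter_def fun_eq_iff)
  ultimately show "\<exists>y\<in>carrier lamplighter. y \<otimes>\<^bsub>lamplighter\<^esub> x = \<one>\<^bsub>lamplighter\<^esub>"
    by blast
qed

interpretation lamplighter: group lamplighter
  by (rule group_lamplighter)

lemma gen_a_closed [simp, intro]: "gen_a \<in> carrier lamplighter"
  by (simp add: gen_a_def lamplighter_def lamp_configs_def)

lemma gen_b_closed [simp, intro]: "gen_b \<in> carrier lamplighter"
proof -
  have "{e::rat. (if e = 1/2 then 1 else 0::bit) \<noteq> 0} = {1/2}" by auto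
  moreover have "1/2 \<in> half_integers"
    unfolding half_integers_def by (rule range_eqI[of _ _ 0]) simp
  ultimately show ?thesis
    unfolding gen_b_def lamplighter_def lamp_configs_def by simp
qed

lemma inv_gen_b: "inv\<^bsub>lamplighter\<^esub> gen_b = (\<lambda>e. if e = - 1/2 then 1 else 0, - 1)"
proof (rule lamplighter.inv_equality)
  show "(\<lambda>e. if e = - 1/2 then 1 else 0, - 1) \<otimes>\<^bsub>lamplighter\<^esub> gen_b = \<one>\<^bsub>lamplighter\<^esub>"
    by (auto simp: gen_b_def lamplighter_def fun_eq_iff algebra_simps)
  show "(\<lambda>e. if e = - 1/2 then 1 else 0, - 1) \<in> carrier lamplighter"
    by (auto simp: lamplighter_def lamp_configs_def half_integers_def
        intro: range_eqI[of _ _ "- 1"])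
qed simp

lemma tetrahedron_switch:
  "gen_a \<otimes>\<^bsub>lamplighter\<^esub> (inv\<^bsub>lamplighter\<^esub> gen_b \<otimes>\<^bsub>lamplighter\<^esub> gen_a) = gen_b"
  unfolding inv_gen_b
  by (auto simp: gen_a_def gen_b_def lamplighter_def fun_eq_iff)

lemma shift_closed:
  assumes "x \<in> colourings C" "g \<in> carrier lamplighter"
  shows "shift C g x \<in> colourings C"
  using assms by (auto simp: shift_def colourings_def)

lemma shift_shift:
  assumes "x \<in> colourings C" "g \<in> carrier lamplighter" "k \<in> carrier lamplighter"
  shows "shift C g (shift C k x) = shift C (g \<otimes>\<^bsub>lamplighter\<^esub> k) x"
  using assms shift_closed[of x C k]
  by (auto simp: shift_def fun_eq_iff restrict_def lamplighter.m_assoc)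

lemma shift_one:
  assumes "x \<in> colourings C"
  shows "shift C \<one>\<^bsub>lamplighter\<^esub> x = x"
  using assms by (auto simp: shift_def colourings_def fun_eq_iff restrict_def PiE_def extensional_def)

lemma shift_action: "group_action lamplighter (colourings C) (shift C)"
proof -
  have bij: "shift C g \<in> Bij (colourings C)" if g: "g \<in> carrier lamplighter" for g
  proof -
    have "bij_betw (shift C g) (colourings C) (colourings C)"
      by (rule bij_betwI[where g = "shift C (inv\<^bsub>lamplighter\<^esub> g)"])
        (use g in \<open>auto simp: shift_closed shift_shift shift_one\<close>)
    then show ?thesis by (simp add: Bij_def shift_def)
  qed
  have "shift C (g \<otimes>\<^bsub>lamplighter\<^esub> k) = compose (colourings C) (shift C g) (shift C k)"
    if "g \<in> carrier lamplighter" "k \<in> carrier lamplighter" for g k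
    by (rule extensionalityI[of _ "colourings C"])
      (use that in \<open>auto simp: compose_def shift_shift, simp add: shift_def\<close>)
  then have "shift C \<in> hom lamplighter (BijGroup (colourings C))"
    using bij by (auto simp: hom_def BijGroup_def)
  then show ?thesis
    by (simp add: group_action_def group_hom_def group_hom_axioms_def
        group_lamplighter group_BijGroup)
qed

lemma shift_tetra_SFT:
  assumes "x \<in> tetra_SFT C \<Delta>" "g \<in> carrier lamplighter"
  shows "shift C g x \<in> tetra_SFT C \<Delta>"
  using assms shift_closed[of x C g]
  by (auto simp: tetra_SFT_def shift_def lamplighter.m_assoc)

end

theory Submission
  imports Defs "HOL-Library.Countable"
begin

text \<open>
  Encode a vertex by the finite set \<open>A\<close> of its lit lamps and its level \<open>n\<close>; the tetrahedron at
  \<open>(A, n)\<close> toggles lamp \<open>n\<close> and passes from level \<open>n\<close> to level \<open>n + 1\<close>.  Marks modulo 5 encode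
  part of the colour of a vertex in the unordered pair of marks above (respectively below) it.
  By induction on the distance of the lamps, that part then depends only on the lamps left of
  \<open>n\<close> (respectively right of \<open>n\<close>), which excludes torsion periods and makes the bit \<open>divides\<close> a
  function of the level.

  The right half of the configuration carries a hierarchy of long and short cells that grows by
  the golden ratio per level, whereas the dividing levels split the counts in two.  The local
  balance of counts therefore forces the number of dividing levels among any \<open>k\<close> consecutive ones
  to be \<open>k log\<^sub>2 \<phi> + O(1)\<close>, which is impossible for a periodic sequence, as no power of the golden
  ratio \<open>\<phi>\<close> is an integer.  Counting integer points in translated intervals realises the balance.
\<close>

section \<open>The golden ratio\<close>

definition golden :: real
  where "golden = (1 + sqrt 5) / 2"

lemma golden_square: "golden * golden = golden + 1"
  by (simp add: golden_def field_simps)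

lemma golden_gt_1: "1 < golden"
  by (simp add: golden_def)

lemma golden_lt_2: "golden < 2"
  by (simp add: golden_def real_less_lsqrt)

text \<open>Infinite descent: parity forces \<open>a\<close> and \<open>c\<close> to be even, and
  halving both preserves the equation, which is what \<open>golden_square\<close> gives for
  \<open>golden = c / a\<close>.\<close>

lemma no_rational_golden:
  fixes a c :: int
  assumes "c * c = c * a + a * a"
  shows "a = 0"
  using assms
proof (induction "nat \<bar>a\<bar>" arbitrary: a c rule: less_induct)
  case less
  have "even a \<and> even c"
  proof -
    have "even (c * c) \<longleftrightarrow> even (c * a + a * a)" using less.prems by simp
    then show ?thesis by (cases "even a"; cases "even c") simp_all
  qed
  then obtain b d where bd: "a = 2 * b" "c = 2 * d" by (auto elim!: evenE)
  have "d * d = d * b + b * b" using less.prems by (simp add: bd)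
  then have "b = 0" if "b \<noteq> 0" using less.hyps[of b d] that by (simp add: bd abs_mult)
  then show ?case using bd by auto
qed

text \<open>Reducing by \<open>golden_square\<close> leaves a linear expression in
  \<open>golden\<close> with positive leading coefficient, so a natural value would make
  \<open>golden\<close> rational.\<close>

lemma golden_power_not_nat: "golden ^ Suc p \<noteq> real w"
proof
  assume eq: "golden ^ Suc p = real w"
  have "\<exists>a b :: nat. a > 0 \<and> golden ^ Suc p = real a * golden + real b"
  proof (induction p)
    case 0
    show ?case by (rule exI[of _ 1], rule exI[of _ 0]) simp
  next
    case (Suc p)
    then obtain a b :: nat where ab: "a > 0" "golden ^ Suc p = real a * golden + real b" by blast
    have "golden ^ Suc (Suc p) = golden * (real a * golden + real b)"
      using ab by simp
    also have "\<dots> = real a * (golden * golden) + real b * golden" by (simp add: algebra_simps)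
    also have "\<dots> = real (a + b) * golden + real a"
      unfolding golden_square by (simp add: algebra_simps)
    finally show ?case using ab by (intro exI[of _ "a + b"] exI[of _ a]) simp
  qed
  then obtain a b :: nat where ab: "a > 0" "real a * golden = real_of_int (int w - int b)"
    using eq by auto
  define c where "c = int w - int b"
  have c: "real a * golden = real_of_int c" using ab by (simp add: c_def)
  have "(real a * golden) * (real a * golden) = real a * real a * (golden * golden)" by simp
  also have "\<dots> = (real a * golden) * real a + real a * real a"
    unfolding golden_square by (simp add: algebra_simps)
  finally have "real_of_int (c * c) = real_of_int (c * int a + int a * int a)"
    unfolding c by simp
  then have "c * c = c * int a + int a * int a" by (simp only: of_int_eq_iff)
  from no_rational_golden[OF this] ab show False by simp
qed

section \<open>Tetrahedra\<close>

datatype colour = Colour (divides: bool) (lmark: nat) (rmark: nat) (short: bool) (count: nat)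

instance colour :: countable
  by countable_datatype

text \<open>
  The five residues modulo 5 let an unordered pair of marks reveal both its base \<open>j\<close> and the bit
  \<open>d\<close>: the ten unordered pairs of distinct residues are exactly the \<open>{j, j + 1 + d}\<close>.
\<close>

definition partner :: "nat \<Rightarrow> bool \<Rightarrow> nat"
  where "partner j d = (j + (if d then 2 else 1)) mod 5"

lemma partner_less: "partner j d < 5"
  by (simp add: partner_def)

lemma partner_eq_if:
  assumes "j < 5"
  shows "partner j d =
    (if d then if j < 3 then j + 2 else j - 3 else if j < 4 then j + 1 else j - 4)"
proof -
  have "(j + r) mod 5 = (if j + r < 5 then j + r else j + r - 5)" if "r \<le> 2" for r
    using assms that by (simp add: le_mod_geq)
  from this[of 1] this[of 2] show ?thesis by (auto simp: partner_def)
qed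

lemma partner_neq: "j < 5 \<Longrightarrow> partner j d \<noteq> j"
  by (auto simp: partner_eq_if)

lemma partner_pair_eqD:
  assumes "{j, partner j d} = {k, partner k e}" "j < 5" "k < 5"
  shows "j = k \<and> d = e"
proof -
  have "j \<in> {0, 1, 2, 3, 4}" "k \<in> {0, 1, 2, 3, 4}" using assms by auto
  with assms(1) show ?thesis
    unfolding doubleton_eq_iff by (cases d; cases e) (auto simp: partner_eq_if)
qed

text \<open>Here \<open>d\<close> is the bit of the bottom level, \<open>t\<close> the shortness of
  the two top vertices; \<open>x1\<close>, \<open>x3\<close> are bottom counts and
  \<open>x2\<close>, \<open>x4\<close> top counts. Positivity is demanded exactly of the long
  vertices.\<close>

definition balanced :: "bool \<Rightarrow> bool \<Rightarrow> nat \<Rightarrow> nat \<Rightarrow> nat \<Rightarrow> nat \<Rightarrow> bool"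
  where "balanced d t x1 x2 x3 x4 \<longleftrightarrow>
    (if t then 1 else 2) * (x1 + x3) = (if d then 2 else 1) * (x2 + x4) \<and>
    0 < x1 \<and> (t \<longrightarrow> 0 < x3) \<and> (\<not> t \<longrightarrow> 0 < x2 \<and> 0 < x4) \<and>
    x1 \<le> 2 \<and> x2 \<le> 2 \<and> x3 \<le> 2 \<and> x4 \<le> 2"

text \<open>The top pair of left marks reveals \<open>(j, d)\<close>, the bottom pair of right marks
  reveals \<open>(i, d')\<close>. The first vertex is always long; the switch supplies the other
  orientation.\<close>

definition tetra :: "nat \<times> nat \<times> bool \<times> bool \<times> bool \<times> nat \<times> nat \<times> nat \<times> nat \<Rightarrow> colour tetrahedron"
  where "tetra = (\<lambda>(j, i, d', d, t, x1, x2, x3, x4).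
    (Colour d j i False x1, Colour d' j i t x2,
     Colour d j (partner i d') (\<not> t) x3, Colour d' (partner j d) i t x4))"

definition tiles :: "colour tetrahedron set"
  where "tiles = tetra ` ({..<5} \<times> {..<5} \<times> UNIV \<times>
    {(d, t, x1, x2, x3, x4). balanced d t x1 x2 x3 x4})"

text \<open>Filtering an explicit finite box makes the cardinality computable by
  enumeration.\<close>

lemma balanced_set:
  "{(d, t, x1, x2, x3, x4). balanced d t x1 x2 x3 x4} =
   Set.filter (\<lambda>(d, t, x1, x2, x3, x4). balanced d t x1 x2 x3 x4)
    ({False, True} \<times> {False, True} \<times> {..2} \<times> {..2} \<times> {..2} \<times> {..2})"
  unfolding balanced_def by auto

lemma card_balanced: "card {(d, t, x1, x2, x3, x4). balanced d t x1 x2 x3 x4} = 23"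
  unfolding balanced_set by code_simp

lemma finite_balanced: "finite {(d, t, x1, x2, x3, x4). balanced d t x1 x2 x3 x4}"
  by (rule card_ge_0_finite) (simp add: card_balanced)

lemma finite_tiles: "finite tiles"
  unfolding tiles_def using finite_balanced by simp

text \<open>Parameter count: 5 * 5 * 2 * 23. Padding fills the gap up to 1488.\<close>

lemma card_tiles: "card tiles \<le> 1150"
proof -
  have "card tiles \<le> card ({..<5::nat} \<times> {..<5::nat} \<times> (UNIV :: bool set) \<times>
    {(d, t, x1, x2, x3, x4). balanced d t x1 x2 x3 x4})"
    unfolding tiles_def by (intro card_image_le finite_cartesian_product finite_balanced) auto
  also have "\<dots> = 1150" unfolding card_cartesian_product card_balanced by simp
  finally show ?thesis .
qed

text \<open>All that the aperiodicity argument reads off a tetrahedron, in a form that survives the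
  switch.\<close>

lemma completion_tilesD:
  assumes "(c1, c2, c3, c4) \<in> completion tiles"
  shows "lmark c1 < 5" "{lmark c2, lmark c4} = {lmark c1, partner (lmark c1) (divides c1)}"
    "rmark c2 < 5" "{rmark c1, rmark c3} = {rmark c2, partner (rmark c2) (divides c2)}"
    "lmark c2 \<noteq> lmark c4" "short c2 \<longleftrightarrow> \<not> short c1 \<and> \<not> short c3" "\<not> (short c1 \<and> short c3)"
    "(if short c2 then 1 else 2) * (count c1 + count c3) =
      (if divides c1 then 2 else 1) * (count c2 + count c4)"
    "count c1 \<le> 2" "short c1 \<or> 0 < count c1"
  using assms
  by (auto simp: completion_def tiles_def tetra_def balanced_def partner_less partner_neq
      dest: sym[of "lmark _"] split: if_splits)

section \<open>Aperiodicity\<close>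

definition toggle :: "int \<Rightarrow> int set \<Rightarrow> int set"
  where "toggle n A = (if n \<in> A then A - {n} else insert n A)"

lemma finite_toggle [simp]: "finite (toggle n A) \<longleftrightarrow> finite A"
  by (simp add: toggle_def)

lemma mem_toggle: "i \<in> toggle n A \<longleftrightarrow> (if i = n then i \<notin> A else i \<in> A)"
  by (auto simp: toggle_def)

lemma toggle_toggle [simp]: "toggle n (toggle n A) = A"
  by (auto simp: set_eq_iff mem_toggle)

lemma toggle_commute: "toggle i (toggle j A) = toggle j (toggle i A)"
  by (auto simp: set_eq_iff mem_toggle)

locale tiling =
  fixes f :: "int set \<Rightarrow> int \<Rightarrow> colour"
  assumes tile: "finite A \<Longrightarrow>
    (f A n, f A (n + 1), f (toggle n A) n, f (toggle n A) (n + 1)) \<in> completion tiles"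
begin

section \<open>Colour components determined by one half of the lamps\<close>

lemmas tileD = completion_tilesD[OF tile]

text \<open>Induction on the length \<open>d\<close> of the window \<open>{n..<n + d}\<close> in
  which the lamps may differ. The pair of left marks at level \<open>n + 1\<close> determines mark
  and bit at \<open>n\<close>, and one level up the window is shorter.\<close>

lemma left_determined:
  assumes "finite A" "finite B" "\<And>i. i < n \<Longrightarrow> i \<in> A \<longleftrightarrow> i \<in> B"
  shows "lmark (f A n) = lmark (f B n) \<and> divides (f A n) = divides (f B n)"
proof -
  have "lmark (f A n) = lmark (f B n) \<and> divides (f A n) = divides (f B n)"
    if "finite A" "finite B" "\<And>i. i < n \<or> n + int d \<le> i \<Longrightarrow> i \<in> A \<longleftrightarrow> i \<in> B" for A B n d
    using that
  proof (induction d arbitrary: A B n)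
    case 0
    then have "A = B" by (metis add.right_neutral linorder_le_less_linear of_nat_0 subsetI subset_antisym)
    then show ?case by simp
  next
    case (Suc d)
    have *: "lmark (f A (n + 1)) = lmark (f B' (n + 1))"
      if "finite A" "finite B'"
        "n \<in> A \<longleftrightarrow> n \<in> B'" "\<And>i. i < n \<or> n + int (Suc d) \<le> i \<Longrightarrow> i \<in> A \<longleftrightarrow> i \<in> B'" for A B'
    proof -
      have "i \<in> A \<longleftrightarrow> i \<in> B'" if "i < n + 1 \<or> n + 1 + int d \<le> i" for i
        using that \<open>n \<in> A \<longleftrightarrow> n \<in> B'\<close> \<open>i < n \<or> n + int (Suc d) \<le> i \<Longrightarrow> i \<in> A \<longleftrightarrow> i \<in> B'\<close>
        by (cases "i = n") auto
      then show ?thesis using Suc.IH[OF that(1,2), of "n + 1"] by blast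
    qed
    have "{lmark (f A (n + 1)), lmark (f (toggle n A) (n + 1))} =
      {lmark (f B (n + 1)), lmark (f (toggle n B) (n + 1))}"
    proof (cases "n \<in> A \<longleftrightarrow> n \<in> B")
      case True
      have "lmark (f A (n + 1)) = lmark (f B (n + 1))"
        by (rule *) (use Suc.prems True in auto)
      moreover have "lmark (f (toggle n A) (n + 1)) = lmark (f (toggle n B) (n + 1))"
        by (rule *) (use Suc.prems True in \<open>auto simp: mem_toggle\<close>)
      ultimately show ?thesis by simp
    next
      case False
      \<comment> \<open>Marks are read as an unordered pair, so when lamp \<open>n\<close> differs
        the two members are matched crosswise.\<close>
      have "lmark (f A (n + 1)) = lmark (f (toggle n B) (n + 1))"
        by (rule *) (use Suc.prems False in \<open>auto simp: mem_toggle\<close>)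
      moreover have "lmark (f (toggle n A) (n + 1)) = lmark (f B (n + 1))"
        by (rule *) (use Suc.prems False in \<open>auto simp: mem_toggle\<close>)
      ultimately show ?thesis by auto
    qed
    then show ?case
      using partner_pair_eqD[of "lmark (f A n)" "divides (f A n)" "lmark (f B n)" "divides (f B n)"]
        tileD(1,2)[OF Suc.prems(1), of n] tileD(1,2)[OF Suc.prems(2), of n] by auto
  qed
  note main = this
  \<comment> \<open>Finitely many lit lamps fit into a finite window.\<close>
  obtain N where N: "\<And>i. i \<in> A \<union> B \<Longrightarrow> i < N"
  proof
    show "i < Max (insert 0 (A \<union> B)) + 1" if "i \<in> A \<union> B" for i
      using that assms(1,2) by (simp add: le_imp_less_Suc zle_add1_eq_le)
  qed
  show ?thesis
  proof (rule main[of A B n "nat (N - n)"])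
    show "i \<in> A \<longleftrightarrow> i \<in> B" if "i < n \<or> n + int (nat (N - n)) \<le> i" for i
      using that assms(3) N[of i] by force
  qed (use assms in auto)
qed

text \<open>Mirror image, descending in levels: the pair below a vertex determines its right mark
  and bit, and also its shortness. The right mark is carried along for the induction.\<close>

lemma right_determined:
  assumes "finite A" "finite B" "\<And>i. n \<le> i \<Longrightarrow> i \<in> A \<longleftrightarrow> i \<in> B"
  shows "divides (f A n) = divides (f B n) \<and> short (f A n) = short (f B n)"
proof -
  have "rmark (f A n) = rmark (f B n) \<and> divides (f A n) = divides (f B n) \<and>
      short (f A n) = short (f B n)"
    if "finite A" "finite B" "\<And>i. i < n - int d \<or> n \<le> i \<Longrightarrow> i \<in> A \<longleftrightarrow> i \<in> B" for A B n d
    using that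
  proof (induction d arbitrary: A B n)
    case 0
    then have "A = B" by (metis diff_0_right linorder_le_less_linear of_nat_0 subsetI subset_antisym)
    then show ?case by simp
  next
    case (Suc d)
    define m where "m = n - 1"
    have n: "n = m + 1" by (simp add: m_def)
    have *: "rmark (f A m) = rmark (f B' m) \<and> short (f A m) = short (f B' m)"
      if "finite A" "finite B'"
        "m \<in> A \<longleftrightarrow> m \<in> B'" "\<And>i. i < n - int (Suc d) \<or> n \<le> i \<Longrightarrow> i \<in> A \<longleftrightarrow> i \<in> B'" for A B'
    proof -
      have "i \<in> A \<longleftrightarrow> i \<in> B'" if "i < m - int d \<or> m \<le> i" for i
        using that \<open>m \<in> A \<longleftrightarrow> m \<in> B'\<close> \<open>i < n - int (Suc d) \<or> n \<le> i \<Longrightarrow> i \<in> A \<longleftrightarrow> i \<in> B'\<close>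
        by (cases "i = m") (auto simp: n)
      then show ?thesis using Suc.IH[OF that(1,2), of m] by blast
    qed
    have "{rmark (f A m), rmark (f (toggle m A) m)} = {rmark (f B m), rmark (f (toggle m B) m)} \<and>
      (\<not> short (f A m) \<and> \<not> short (f (toggle m A) m) \<longleftrightarrow>
       \<not> short (f B m) \<and> \<not> short (f (toggle m B) m))"
    proof (cases "m \<in> A \<longleftrightarrow> m \<in> B")
      case True
      have "rmark (f A m) = rmark (f B m) \<and> short (f A m) = short (f B m)"
        by (rule *) (use Suc.prems True in auto)
      moreover have "rmark (f (toggle m A) m) = rmark (f (toggle m B) m) \<and>
          short (f (toggle m A) m) = short (f (toggle m B) m)"
        by (rule *) (use Suc.prems True in \<open>auto simp: mem_toggle n\<close>)
      ultimately show ?thesis by simp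
    next
      case False
      have "rmark (f A m) = rmark (f (toggle m B) m) \<and> short (f A m) = short (f (toggle m B) m)"
        by (rule *) (use Suc.prems False in \<open>auto simp: mem_toggle n\<close>)
      moreover have "rmark (f (toggle m A) m) = rmark (f B m) \<and> short (f (toggle m A) m) = short (f B m)"
        by (rule *) (use Suc.prems False in \<open>auto simp: mem_toggle n\<close>)
      ultimately show ?thesis by auto
    qed
    then show ?case
      using partner_pair_eqD[of "rmark (f A n)" "divides (f A n)" "rmark (f B n)" "divides (f B n)"]
        tileD(3,4,6)[OF Suc.prems(1), of m] tileD(3,4,6)[OF Suc.prems(2), of m]
      unfolding n by auto
  qed
  note main = this
  obtain N where N: "\<And>i. i \<in> A \<union> B \<Longrightarrow> N \<le> i"
  proof
    show "Min (insert 0 (A \<union> B)) \<le> i" if "i \<in> A \<union> B" for i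
      using that assms(1,2) by simp
  qed
  have "rmark (f A n) = rmark (f B n) \<and> divides (f A n) = divides (f B n) \<and>
      short (f A n) = short (f B n)"
  proof (rule main[of A B n "nat (n - N)"])
    show "i \<in> A \<longleftrightarrow> i \<in> B" if "i < n - int (nat (n - N)) \<or> n \<le> i" for i
    proof (cases "n \<le> i")
      case False
      then have "i < N" using that by linarith
      then show ?thesis using N[of i] by auto
    qed (use assms(3) in simp)
  qed (use assms in auto)
  then show ?thesis by blast
qed

definition level_divides :: "int \<Rightarrow> bool"
  where "level_divides n = divides (f {} n)"

text \<open>The bit is determined from either side, so the lamps from \<open>n\<close> on can be
  erased first and those below \<open>n\<close> afterwards.\<close>

lemma divides_eq_level:
  assumes "finite A"
  shows "divides (f A n) = level_divides n"
proof -
  let ?B = "{i \<in> A. i < n}"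
  have "divides (f A n) = divides (f ?B n)"
    using assms left_determined[of A ?B n] by simp
  also have "\<dots> = divides (f {} n)"
    using assms right_determined[of ?B "{}" n] by simp
  finally show ?thesis by (simp add: level_divides_def)
qed

text \<open>Just above its lowest lamp \<open>p\<close>, \<open>S\<close> looks from the left like
  \<open>{p}\<close>, and the tetrahedron at \<open>({}, p)\<close> has distinct left marks on
  top.\<close>

lemma lamps_not_period:
  assumes "finite S" "S \<noteq> {}"
  shows "\<exists>n. f S n \<noteq> f {} n"
proof -
  define p where "p = Min S"
  have p: "p \<in> S" "\<And>i. i \<in> S \<Longrightarrow> p \<le> i" using assms by (simp_all add: p_def)
  have "lmark (f S (p + 1)) = lmark (f (toggle p {}) (p + 1))"
  proof (rule conjunct1[OF left_determined])
    show "i \<in> S \<longleftrightarrow> i \<in> toggle p {}" if "i < p + 1" for i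
      using that p(1) p(2)[of i] by (cases "i = p") (auto simp: mem_toggle)
  qed (use assms in auto)
  then have "lmark (f S (p + 1)) \<noteq> lmark (f {} (p + 1))"
    using tileD(5)[of "{}" p] by simp
  then show ?thesis by metis
qed

section \<open>Dividing levels against the golden ratio\<close>

definition level_growth :: "int \<Rightarrow> nat"
  where "level_growth n = (if level_divides n then 2 else 1)"

definition growth :: "int \<Rightarrow> nat \<Rightarrow> nat"
  where "growth m k = (\<Prod>i<k. level_growth (m + int i))"

lemma growth_0 [simp]: "growth m 0 = 1"
  by (simp add: growth_def)

lemma growth_Suc: "growth m (Suc k) = level_growth m * growth (m + 1) k"
  by (simp add: growth_def prod.lessThan_Suc_shift add.assoc del: prod.lessThan_Suc)

lemma growth_add: "growth m (k + l) = growth m k * growth (m + int k) l"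
  by (induction k arbitrary: m) (simp_all add: growth_Suc algebra_simps)

lemma growth_pos: "0 < growth m k"
  by (simp add: growth_def level_growth_def)

text \<open>
  \<open>cone_sum k A m\<close> is the weighted total count over the \<open>2 ^ k\<close> vertices at level \<open>m\<close> that
  agree with \<open>A\<close> outside \<open>{m..<m + k}\<close>; the two halves of a short cell are copies of each other
  and get averaged.
\<close>

fun cone_sum :: "nat \<Rightarrow> int set \<Rightarrow> int \<Rightarrow> real"
  where
    "cone_sum 0 A m = real (count (f A m))"
  | "cone_sum (Suc k) A m =
      (if short (f A (m + 1 + int k)) then 1 / 2 else 1) *
      (cone_sum k A m + cone_sum k (toggle (m + int k) A) m)"

lemma short_toggle:
  assumes "finite A" "i < n"
  shows "short (f (toggle i A) n) = short (f A n)"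
  by (rule conjunct2[OF right_determined]) (use assms in \<open>auto simp: mem_toggle\<close>)

text \<open>The definition splits off the highest lamp; this recursion splits off the lowest one,
  where the balance of counts applies.\<close>

lemma cone_sum_up:
  assumes "finite A"
  shows "cone_sum (Suc k) A m =
    level_growth m / 2 * (cone_sum k A (m + 1) + cone_sum k (toggle m A) (m + 1))"
  using assms
proof (induction k arbitrary: A)
  case 0
  have "real ((if short (f A (m + 1)) then 1 else 2) * (count (f A m) + count (f (toggle m A) m))) =
    real ((if divides (f A m) then 2 else 1) * (count (f A (m + 1)) + count (f (toggle m A) (m + 1))))"
    using tileD(8)[OF 0, of m] by simp
  then show ?case
    using divides_eq_level[OF 0, of m]
    by (cases "level_divides m"; cases "short (f A (m + 1))") (auto simp: level_growth_def)
next
  case (Suc k)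
  let ?B = "toggle (m + 1 + int k) A"
  define w where "w = (if short (f A (m + 1 + int (Suc k))) then 1 / 2 else 1 :: real)"
  define g where "g = real (level_growth m) / 2"
  have "cone_sum (Suc (Suc k)) A m = w * (cone_sum (Suc k) A m + cone_sum (Suc k) ?B m)"
    by (simp add: w_def algebra_simps)
  also have "\<dots> = g * (w * (cone_sum k A (m + 1) + cone_sum k ?B (m + 1)) +
      w * (cone_sum k (toggle m A) (m + 1) + cone_sum k (toggle m ?B) (m + 1)))"
    using Suc.IH[of A] Suc.IH[of ?B] Suc.prems by (simp add: g_def algebra_simps)
  also have "w * (cone_sum k A (m + 1) + cone_sum k ?B (m + 1)) = cone_sum (Suc k) A (m + 1)"
    by (simp add: w_def algebra_simps)
  \<comment> \<open>Shortness at the top ignores lamp \<open>m\<close>, so \<open>A\<close> and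
    \<open>toggle m A\<close> carry the same weight.\<close>
  also have "w * (cone_sum k (toggle m A) (m + 1) + cone_sum k (toggle m ?B) (m + 1)) =
      cone_sum (Suc k) (toggle m A) (m + 1)"
    using short_toggle[OF Suc.prems, of m "m + 1 + int (Suc k)"]
    by (simp add: w_def algebra_simps toggle_commute[of m])
  finally show ?case by (simp add: g_def)
qed

lemma cone_sum_le_growth: "finite A \<Longrightarrow> cone_sum k A m \<le> 2 * real (growth m k)"
proof (induction k arbitrary: A m)
  case 0
  then show ?case using tileD(9)[OF 0, of m] by simp
next
  case (Suc k)
  have "level_growth m / 2 * (cone_sum k A (m + 1) + cone_sum k (toggle m A) (m + 1)) \<le>
    level_growth m / 2 * (2 * real (growth (m + 1) k) + 2 * real (growth (m + 1) k))"
    using Suc by (intro mult_left_mono add_mono) auto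
  then show ?case unfolding cone_sum_up[OF Suc.prems] growth_Suc by simp
qed

text \<open>Each step averages two cones with long apex, and a long vertex has count at least
  1.\<close>

lemma cone_sum_ge_growth:
  "finite A \<Longrightarrow> \<not> short (f A (m + int k)) \<Longrightarrow> real (growth m k) \<le> cone_sum k A m"
proof (induction k arbitrary: A m)
  case 0
  then show ?case using tileD(10)[OF 0(1), of m] by simp
next
  case (Suc k)
  have "\<not> short (f (toggle m A) (m + 1 + int k))"
    using short_toggle[OF Suc.prems(1), of m "m + 1 + int k"] Suc.prems by (simp add: algebra_simps)
  then have "level_growth m / 2 * (real (growth (m + 1) k) + real (growth (m + 1) k)) \<le>
    level_growth m / 2 * (cone_sum k A (m + 1) + cone_sum k (toggle m A) (m + 1))"
    using Suc by (intro mult_left_mono add_mono) (auto simp: algebra_simps)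
  then show ?case unfolding cone_sum_up[OF Suc.prems(1)] growth_Suc by simp
qed

text \<open>Recursion from the top: a long cone is the sum of a long and a short one, a short cone
  the mean of two long ones. The bounds reproduce themselves by
  \<open>golden_square\<close>.\<close>

lemma cone_sum_le_golden:
  "finite A \<Longrightarrow> cone_sum k A m \<le> 2 * golden ^ k * (if short (f A (m + int k)) then 1 else golden)"
proof (induction k arbitrary: A)
  case 0
  then show ?case using tileD(9)[OF 0, of m] golden_gt_1 by simp
next
  case (Suc k)
  let ?B = "toggle (m + int k) A"
  note IH = Suc.IH[of A] Suc.IH[of ?B]
  have shorts: "short (f A (m + 1 + int k)) \<longleftrightarrow> \<not> short (f A (m + int k)) \<and> \<not> short (f ?B (m + int k))"
    "\<not> (short (f A (m + int k)) \<and> short (f ?B (m + int k)))"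
    using tileD(6,7)[OF Suc.prems, of "m + int k"] by (simp_all add: algebra_simps)
  have sq: "golden ^ k * golden * golden = golden ^ k * golden + golden ^ k"
    using golden_square by (metis distrib_left mult.assoc mult.right_neutral)
  show ?case
  proof (cases "short (f A (m + 1 + int k))")
    case True
    then show ?thesis using IH Suc.prems shorts by (simp add: algebra_simps)
  next
    case False
    then have "short (f A (m + int k)) \<noteq> short (f ?B (m + int k))" using shorts by blast
    then have "cone_sum k A m + cone_sum k ?B m \<le> 2 * golden ^ k * golden + 2 * golden ^ k"
      using IH Suc.prems by (auto split: if_splits)
    then show ?thesis using False sq by (simp add: algebra_simps)
  qed
qed

text \<open>A short vertex may have count 0, so the induction starts one level up, where every cone
  contains a long vertex.\<close>

lemma cone_sum_ge_golden:
  "finite A \<Longrightarrow> golden ^ k \<le> cone_sum (Suc k) A m * (if short (f A (m + 1 + int k)) then golden else 1)"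
proof (induction k arbitrary: A)
  case 0
  show ?case
  proof (cases "short (f A (m + 1))")
    case True
    have "1 * 1 \<le> cone_sum (Suc 0) A m * golden"
      using True tileD(6,10)[OF 0, of m] tileD(10)[of "toggle m A" m] 0 golden_gt_1
      by (intro mult_mono) auto
    then show ?thesis using True by simp
  next
    case False
    then show ?thesis
      using tileD(6,7,10)[OF 0, of m] tileD(10)[of "toggle m A" m] 0 by auto
  qed
next
  case (Suc k)
  let ?B = "toggle (m + 1 + int k) A"
  note IH = Suc.IH[of A] Suc.IH[of ?B]
  have shorts: "short (f A (m + 2 + int k)) \<longleftrightarrow>
      \<not> short (f A (m + 1 + int k)) \<and> \<not> short (f ?B (m + 1 + int k))"
    "\<not> (short (f A (m + 1 + int k)) \<and> short (f ?B (m + 1 + int k)))"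
    using tileD(6,7)[OF Suc.prems, of "m + 1 + int k"] by (simp_all add: algebra_simps)
  let ?a = "cone_sum (Suc k) A m" and ?b = "cone_sum (Suc k) ?B m"
  have unfold: "cone_sum (Suc (Suc k)) A m = (if short (f A (m + 2 + int k)) then 1 / 2 else 1) * (?a + ?b)"
    by (simp add: algebra_simps)
  show ?case
  proof (cases "short (f A (m + 2 + int k))")
    case True
    then have "golden ^ k \<le> ?a" "golden ^ k \<le> ?b" using IH Suc.prems shorts by auto
    then have "golden * golden ^ k \<le> golden * ((?a + ?b) / 2)"
      using golden_gt_1 by (intro mult_left_mono) auto
    then show ?thesis using True unfolding unfold by (simp add: algebra_simps)
  next
    case False
    then have ne: "short (f A (m + 1 + int k)) \<noteq> short (f ?B (m + 1 + int k))" using shorts by blast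
    then have "golden ^ k + golden * golden ^ k \<le> golden * (?a + ?b)"
    proof (cases "short (f A (m + 1 + int k))")
      case True
      then have "golden ^ k \<le> ?a * golden" "golden ^ k \<le> ?b" using IH Suc.prems ne by auto
      moreover from this(2) have "golden * golden ^ k \<le> golden * ?b"
        using golden_gt_1 by (intro mult_left_mono) auto
      ultimately show ?thesis by (simp add: algebra_simps)
    next
      case False
      then have "golden ^ k \<le> ?b * golden" "golden ^ k \<le> ?a" using IH Suc.prems ne by auto
      moreover from this(2) have "golden * golden ^ k \<le> golden * ?a"
        using golden_gt_1 by (intro mult_left_mono) auto
      ultimately show ?thesis by (simp add: algebra_simps)
    qed
    moreover have "golden ^ k + golden * golden ^ k = golden * golden ^ Suc k"
      using golden_square by (simp add: algebra_simps flip: mult.assoc)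
    ultimately have "golden ^ Suc k \<le> ?a + ?b" using golden_gt_1 by simp
    then show ?thesis using False unfolding unfold by (simp add: algebra_simps)
  qed
qed

text \<open>Both estimates are compared on a cone with long apex, which exists because the two
  bottom vertices of a tetrahedron are never both short.\<close>

lemma growth_golden:
  "golden ^ k \<le> 2 * golden * real (growth m k)" "real (growth m k) \<le> 2 * golden * golden ^ k"
proof -
  obtain A where A: "finite A" "\<not> short (f A (m + int k))"
    using tileD(7)[of "{}" "m + int k"] finite_toggle[of "m + int k" "{}"] by blast
  have "real (growth m k) \<le> cone_sum k A m" using cone_sum_ge_growth A by blast
  also have "\<dots> \<le> 2 * golden ^ k * golden" using cone_sum_le_golden[of A k m] A by simp
  finally show "real (growth m k) \<le> 2 * golden * golden ^ k" by (simp add: algebra_simps)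
  show "golden ^ k \<le> 2 * golden * real (growth m k)"
  proof (cases k)
    case 0
    then show ?thesis using golden_gt_1 by simp
  next
    case (Suc l)
    have "golden ^ l \<le> cone_sum k A m"
      using cone_sum_ge_golden[of A l m] A by (simp add: Suc algebra_simps)
    also have "\<dots> \<le> 2 * real (growth m k)" using cone_sum_le_growth A by blast
    finally have "golden * golden ^ l \<le> golden * (2 * real (growth m k))"
      using golden_gt_1 by (intro mult_left_mono) auto
    then show ?thesis by (simp add: Suc algebra_simps)
  qed
qed

text \<open>Under a period \<open>p\<close> the growth over \<open>p * j\<close> levels is
  \<open>w ^ j\<close>. Staying within constant factors of \<open>golden ^ (p * j)\<close> for all
  \<open>j\<close> forces \<open>golden ^ p = w\<close>, a natural number.\<close>

lemma level_divides_not_periodic: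
  assumes "0 < p"
  shows "\<exists>n. level_divides (n + int p) \<noteq> level_divides n"
proof (rule ccontr)
  assume "\<not> ?thesis"
  then have per: "level_divides (n + int p) = level_divides n" for n by blast
  have "growth (m + int p) k = growth m k" for m k
    using per by (simp add: growth_def level_growth_def algebra_simps add.left_commute)
      (metis add.commute add.left_commute)
  then have growth_power: "growth 0 (p * j) = growth 0 p ^ j" for j
    using growth_add[of 0 p] by (induction j) (simp_all, metis add_0)
  define w where "w = growth 0 p"
  have w: "0 < w" using growth_pos by (simp add: w_def)
  have bounds: "(golden ^ p / w) ^ j \<le> 2 * golden" "(w / golden ^ p) ^ j \<le> 2 * golden" for j
  proof -
    have g: "real (growth 0 (p * j)) = real w ^ j" "golden ^ (p * j) = (golden ^ p) ^ j"
      by (simp_all add: growth_power w_def power_mult)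
    have "0 < real w ^ j" "0 < (golden ^ p) ^ j" using w golden_gt_1 by simp_all
    then show "(golden ^ p / w) ^ j \<le> 2 * golden" "(w / golden ^ p) ^ j \<le> 2 * golden"
      using growth_golden(1)[of "p * j" 0] growth_golden(2)[of 0 "p * j"] unfolding g power_divide by (simp_all only: pos_divide_le_eq)
  qed
  have "x \<le> 1" if "\<And>j. x ^ j \<le> 2 * golden" for x :: real
    using that real_arch_pow[of x "2 * golden"] by (meson linorder_not_le)
  from this[OF bounds(1)] this[OF bounds(2)] have "golden ^ p = w"
    using w golden_gt_1 by (simp add: divide_le_eq)
  then show False using golden_power_not_nat[of "p - 1" w] assms by simp
qed

end

section \<open>A tiling\<close>

text \<open>A Sturmian choice of slope \<open>log 2 golden\<close>. The shift to
  \<open>n + 1\<close> makes \<open>height n\<close> the largest power of 2 not exceeding the long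
  length \<open>width (n + 1)\<close>.\<close>

definition splits :: "int \<Rightarrow> int"
  where "splits n = \<lfloor>of_int (n + 1) * log 2 golden\<rfloor>"

definition splitting :: "int \<Rightarrow> bool"
  where "splitting n \<longleftrightarrow> splits (n + 1) = splits n + 1"

definition width :: "int \<Rightarrow> real"
  where "width n = golden powr of_int n"

definition height :: "int \<Rightarrow> real"
  where "height n = 2 powr of_int (splits n)"

lemma splits_Suc: "splits (n + 1) = splits n + (if splitting n then 1 else 0)"
proof -
  let ?y = "of_int (n + 1) * log 2 golden"
  have c: "0 < log 2 golden" "log 2 golden < 1"
    using golden_gt_1 golden_lt_2 by simp_all
  have "splits (n + 1) = \<lfloor>?y + log 2 golden\<rfloor>" by (simp add: splits_def algebra_simps)
  then have "splits (n + 1) = splits n \<or> splits (n + 1) = splits n + 1"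
    unfolding splits_def using c by linarith
  then show ?thesis by (auto simp: splitting_def)
qed

lemma width_pos: "0 < width n"
  using golden_gt_1 by (simp add: width_def)

lemma width_Suc: "width (n + 1) = golden * width n"
  using golden_gt_1 by (simp add: width_def powr_add)

lemma width_Suc_Suc: "golden * width (n + 1) = width (n + 1) + width n"
  unfolding width_Suc by (simp add: golden_square distrib_right flip: mult.assoc)

lemma height_pos: "0 < height n"
  by (simp add: height_def)

lemma height_Suc: "height (n + 1) = (if splitting n then 2 else 1) * height n"
  by (simp add: height_def splits_Suc powr_add)

lemma height_width: "height n \<le> width (n + 1)" "width (n + 1) < 2 * height n"
proof -
  let ?y = "of_int (n + 1) * log 2 golden"
  have w: "width (n + 1) = 2 powr ?y"
    using golden_gt_1 by (simp add: width_def powr_def log_def)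
  have h: "2 * height n = 2 powr (of_int \<lfloor>?y\<rfloor> + 1)"
    by (simp add: height_def splits_def powr_add)
  show "height n \<le> width (n + 1)"
    unfolding w height_def splits_def by (intro powr_mono) auto
  show "width (n + 1) < 2 * height n"
    unfolding w h by (intro powr_less_mono) auto
qed

text \<open>
  A long cell consists of a long and a short one, a short cell of two long copies; so shortness
  alternates along a run of lit lamps.
\<close>

definition odd_run :: "int set \<Rightarrow> int \<Rightarrow> bool"
  where "odd_run A n \<longleftrightarrow> odd (LEAST k. n + int k \<notin> A)"

text \<open>This is the local rule for shortness; finiteness ensures that the run of lit lamps
  ends.\<close>

lemma odd_run_rec:
  assumes "finite A"
  shows "odd_run A n \<longleftrightarrow> n \<in> A \<and> \<not> odd_run A (n + 1)"
proof (cases "n \<in> A")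
  case True
  have "\<not> (range (\<lambda>k. n + int k) \<subseteq> A)"
    using assms finite_subset finite_imageD[of "\<lambda>k. n + int k" UNIV] by (auto simp: inj_on_def)
  then obtain k where "n + int k \<notin> A" by blast
  then have "(LEAST k. n + int k \<notin> A) = Suc (LEAST k. n + int (Suc k) \<notin> A)"
    by (rule Least_Suc) (simp add: True)
  then show ?thesis using True by (simp add: odd_run_def add.assoc)
next
  case False
  then have "(LEAST k. n + int k \<notin> A) = 0" by (intro Least_equality) auto
  with False show ?thesis by (simp add: odd_run_def)
qed

lemma odd_run_insert: "n < m \<Longrightarrow> odd_run (insert n A) m \<longleftrightarrow> odd_run A m"
  by (simp add: odd_run_def)

text \<open>
  The right part of the lamp configuration selects the interval of length \<open>cell\<close> that begins at
  \<open>start\<close>, the left part selects an \<open>offset\<close>. In units of \<open>height\<close>, the count is the number of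
  integers in the interval translated by the offset, so bottom intervals concatenate, and
  halving the unit distributes the integers according to their parity.
\<close>

definition start :: "int set \<Rightarrow> int \<Rightarrow> real"
  where "start A n = (\<Sum>i\<in>{i \<in> A. n \<le> i \<and> odd_run A i}. width (i + 1))"

definition cell :: "int set \<Rightarrow> int \<Rightarrow> real"
  where "cell A n = (if odd_run A n then width n else width (n + 1))"

definition offset :: "int set \<Rightarrow> int \<Rightarrow> real"
  where "offset A n = (\<Sum>i\<in>{i \<in> A. i < n \<and> splitting i}. height i)"

definition points :: "int set \<Rightarrow> int \<Rightarrow> int"
  where "points A n =
    \<lfloor>(start A n + cell A n + offset A n) / height n\<rfloor> - \<lfloor>(start A n + offset A n) / height n\<rfloor>"

definition left_sum :: "int set \<Rightarrow> int \<Rightarrow> nat"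
  where "left_sum A n = (\<Sum>i\<in>{i \<in> A. i < n}. if splitting i then 2 else 1)"

text \<open>Lamp \<open>i\<close> shifts the right mark by the step of \<open>partner\<close> for
  the upper level, hence the bit of \<open>i + 1\<close>; \<open>left_sum\<close> uses that of
  \<open>i\<close>.\<close>

definition right_sum :: "int set \<Rightarrow> int \<Rightarrow> nat"
  where "right_sum A n = (\<Sum>i\<in>{i \<in> A. n \<le> i}. if splitting (i + 1) then 2 else 1)"

definition tiling_colour :: "int set \<Rightarrow> int \<Rightarrow> colour"
  where "tiling_colour A n = Colour (splitting n) (left_sum A n mod 5) (right_sum A n mod 5)
    (odd_run A n) (nat (points A n))"

text \<open>In units of \<open>height n\<close> every cell is shorter than 2 and a long cell has
  length at least 1.\<close>

lemma points_bounds: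
  "0 \<le> points A n" "points A n \<le> 2" "\<not> odd_run A n \<Longrightarrow> 0 < points A n"
proof -
  define y l where "y = (start A n + offset A n) / height n" and "l = cell A n / height n"
  have p: "points A n = \<lfloor>y + l\<rfloor> - \<lfloor>y\<rfloor>"
    by (simp add: points_def y_def l_def add_divide_distrib algebra_simps)
  have "width n \<le> width (n + 1)" using width_pos[of n] golden_gt_1 by (simp add: width_Suc)
  then have "0 < cell A n" "cell A n < 2 * height n"
    using width_pos height_width(2)[of n] by (auto simp: cell_def)
  then have l: "0 < l" "l < 2" using height_pos[of n] by (simp_all add: l_def divide_less_eq)
  then show "0 \<le> points A n" "points A n \<le> 2" unfolding p by linarith+
  assume "\<not> odd_run A n"
  then have "1 \<le> l" using height_width(1)[of n] height_pos[of n] by (simp add: l_def cell_def)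
  then show "0 < points A n" unfolding p by linarith
qed

text \<open>Hermite's identity for two terms.\<close>

lemma floor_halves: "\<lfloor>z / 2\<rfloor> + \<lfloor>(z + 1) / 2\<rfloor> = \<lfloor>z\<rfloor>" for z :: real
proof -
  define a where "a = \<lfloor>z / 2\<rfloor>"
  have a: "of_int a \<le> z / 2" "z / 2 < of_int a + 1" unfolding a_def by linarith+
  show ?thesis
  proof (cases "z < 2 * of_int a + 1")
    case True
    then have "\<lfloor>(z + 1) / 2\<rfloor> = a" "\<lfloor>z\<rfloor> = 2 * a" using a by (auto intro!: floor_unique)
    then show ?thesis by (simp add: a_def)
  next
    case False
    then have "\<lfloor>(z + 1) / 2\<rfloor> = a + 1" "\<lfloor>z\<rfloor> = 2 * a + 1" using a by (auto intro!: floor_unique)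
    then show ?thesis by (simp add: a_def)
  qed
qed

section \<open>The local rule for a tetrahedron with its lamp off\<close>

context
  fixes A :: "int set" and n :: int
  assumes A: "finite A" "n \<notin> A"
begin

lemma odd_run_split:
  "\<not> odd_run A n" "odd_run (insert n A) n \<longleftrightarrow> \<not> odd_run A (n + 1)"
  using A odd_run_rec[of A n] odd_run_rec[of "insert n A" n] odd_run_insert[of n "n + 1" A] by auto

text \<open>Under a long top cell the lit bottom interval is placed right after the unlit one; under
  a short top cell the two coincide.\<close>

lemma start_split:
  "start A n = start A (n + 1)" "start (insert n A) (n + 1) = start A (n + 1)"
  "start (insert n A) n = start A (n + 1) + (if odd_run A (n + 1) then 0 else width (n + 1))"
proof -
  let ?S = "{i \<in> A. n + 1 \<le> i \<and> odd_run A i}"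
  have le: "n \<le> i \<longleftrightarrow> n + 1 \<le> i" if "i \<in> A" for i
    using that A by (cases "i = n") auto
  then have "{i \<in> A. n \<le> i \<and> odd_run A i} = ?S" by blast
  then show "start A n = start A (n + 1)" by (simp add: start_def)
  have S: "{i \<in> insert n A. n + 1 \<le> i \<and> odd_run (insert n A) i} = ?S"
    using odd_run_insert[of n _ A] by auto
  then show "start (insert n A) (n + 1) = start A (n + 1)" by (simp add: start_def)
  have "{i \<in> insert n A. n \<le> i \<and> odd_run (insert n A) i} =
    (if odd_run A (n + 1) then ?S else insert n ?S)"
    unfolding S[symmetric] using odd_run_split(2) le by auto
  moreover have "finite ?S" "n \<notin> ?S" using A by auto
  ultimately show "start (insert n A) n =
      start A (n + 1) + (if odd_run A (n + 1) then 0 else width (n + 1))"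
    by (simp add: start_def)
qed

lemma offset_split:
  "offset A (n + 1) = offset A n" "offset (insert n A) n = offset A n"
  "offset (insert n A) (n + 1) = offset A n + (if splitting n then height n else 0)"
proof -
  let ?S = "{i \<in> A. i < n \<and> splitting i}"
  have "{i \<in> A. i < n + 1 \<and> splitting i} = ?S" using A by (force simp: order.order_iff_strict)
  then show "offset A (n + 1) = offset A n" by (simp add: offset_def)
  have "{i \<in> insert n A. i < n \<and> splitting i} = ?S" by auto
  then show "offset (insert n A) n = offset A n" by (simp add: offset_def)
  have "{i \<in> insert n A. i < n + 1 \<and> splitting i} = (if splitting n then insert n ?S else ?S)"
    using A by (auto simp: order.order_iff_strict)
  moreover have "finite ?S" "n \<notin> ?S" using A by auto
  ultimately show "offset (insert n A) (n + 1) = offset A n + (if splitting n then height n else 0)"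
    by (simp add: offset_def)
qed

lemma left_sum_split:
  "left_sum A (n + 1) = left_sum A n" "left_sum (insert n A) n = left_sum A n"
  "left_sum (insert n A) (n + 1) = left_sum A n + (if splitting n then 2 else 1)"
proof -
  let ?S = "{i \<in> A. i < n}"
  have "{i \<in> A. i < n + 1} = ?S" using A by (force simp: order.order_iff_strict)
  then show "left_sum A (n + 1) = left_sum A n" by (simp add: left_sum_def)
  have "{i \<in> insert n A. i < n} = ?S" by auto
  then show "left_sum (insert n A) n = left_sum A n" by (simp add: left_sum_def)
  have "{i \<in> insert n A. i < n + 1} = insert n ?S"
    using A by (auto simp: order.order_iff_strict)
  moreover have "finite ?S" "n \<notin> ?S" using A by auto
  ultimately show "left_sum (insert n A) (n + 1) = left_sum A n + (if splitting n then 2 else 1)"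
    by (simp add: left_sum_def)
qed

lemma right_sum_split:
  "right_sum A n = right_sum A (n + 1)" "right_sum (insert n A) (n + 1) = right_sum A (n + 1)"
  "right_sum (insert n A) n = right_sum A (n + 1) + (if splitting (n + 1) then 2 else 1)"
proof -
  let ?S = "{i \<in> A. n + 1 \<le> i}"
  have "{i \<in> A. n \<le> i} = ?S" using A by (force simp: order.order_iff_strict)
  then show "right_sum A n = right_sum A (n + 1)" by (simp add: right_sum_def)
  have "{i \<in> insert n A. n + 1 \<le> i} = ?S" by auto
  then show "right_sum (insert n A) (n + 1) = right_sum A (n + 1)" by (simp add: right_sum_def)
  have "{i \<in> insert n A. n \<le> i} = insert n ?S"
    using A by (auto simp: order.order_iff_strict)
  moreover have "finite ?S" "n \<notin> ?S" using A by auto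
  ultimately show "right_sum (insert n A) n =
      right_sum A (n + 1) + (if splitting (n + 1) then 2 else 1)"
    by (simp add: right_sum_def)
qed

text \<open>Both sides equal twice the number of points, in units of \<open>height n\<close>, of the
  top interval translated by the common offset.\<close>

lemma points_balance:
  "(if odd_run A (n + 1) then 1 else 2) * (points A n + points (insert n A) n) =
   (if splitting n then 2 else 1) * (points A (n + 1) + points (insert n A) (n + 1))"
proof -
  define S O' L where "S = start A (n + 1)" and "O' = offset A n" and "L = cell A (n + 1)"
  define F where "F t = \<lfloor>(t + O') / height n\<rfloor>" for t
  have bottoms: "points A n = F (S + width (n + 1)) - F S"
    "points (insert n A) n = (if odd_run A (n + 1) then F (S + width (n + 1)) - F S
      else F (S + width (n + 1) + width n) - F (S + width (n + 1)))"
    by (simp_all add: points_def F_def S_def O'_def cell_def start_split offset_split odd_run_split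
        algebra_simps)
  have L: "L = (if odd_run A (n + 1) then width (n + 1) else width (n + 1) + width n)"
    using width_Suc[of "n + 1"] width_Suc_Suc[of n] by (simp add: L_def cell_def)
  have left: "(if odd_run A (n + 1) then 1 else 2) * (points A n + points (insert n A) n) =
      2 * (F (S + L) - F S)"
    by (simp add: bottoms L algebra_simps)
  have cell: "cell (insert n A) (n + 1) = L"
    by (simp add: cell_def L_def odd_run_insert)
  show ?thesis
  proof (cases "splitting n")
    case False
    then have "points A (n + 1) = F (S + L) - F S" "points (insert n A) (n + 1) = F (S + L) - F S"
      by (simp_all add: points_def F_def S_def O'_def cell start_split offset_split height_Suc
          flip: L_def)
    with False left show ?thesis by simp
  next
    case True
    \<comment> \<open>When the unit doubles, the two top offsets differ by one old unit, so together
      they see each old point once.\<close>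
    have F: "\<lfloor>(t + O') / (2 * height n)\<rfloor> + \<lfloor>(t + (O' + height n)) / (2 * height n)\<rfloor> = F t" for t
    proof -
      have "(t + O') / (2 * height n) = (t + O') / height n / 2"
        "(t + (O' + height n)) / (2 * height n) = ((t + O') / height n + 1) / 2"
        using height_pos[of n] by (simp_all add: field_simps)
      then show ?thesis
        unfolding F_def by (simp only: floor_halves)
    qed
    have "points A (n + 1) =
        \<lfloor>(S + L + O') / (2 * height n)\<rfloor> - \<lfloor>(S + O') / (2 * height n)\<rfloor>"
      "points (insert n A) (n + 1) =
        \<lfloor>(S + L + (O' + height n)) / (2 * height n)\<rfloor> - \<lfloor>(S + (O' + height n)) / (2 * height n)\<rfloor>"
      using True by (simp_all add: points_def S_def O'_def cell start_split offset_split height_Suc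
          flip: L_def)
    with True left F[of "S + L"] F[of S] show ?thesis by simp
  qed
qed

lemma tiling_colour_tiles:
  "(tiling_colour A n, tiling_colour A (n + 1),
    tiling_colour (insert n A) n, tiling_colour (insert n A) (n + 1)) \<in> tiles"
proof -
  let ?x = "\<lambda>A n. nat (points A n)"
  have run: "odd_run (insert n A) (n + 1) = odd_run A (n + 1)" by (simp add: odd_run_insert)
  have "int ((if odd_run A (n + 1) then 1 else 2) * (?x A n + ?x (insert n A) n)) =
    int ((if splitting n then 2 else 1) * (?x A (n + 1) + ?x (insert n A) (n + 1)))"
    using points_balance points_bounds(1) by (simp split: if_splits)
  then have "balanced (splitting n) (odd_run A (n + 1)) (?x A n) (?x A (n + 1))
      (?x (insert n A) n) (?x (insert n A) (n + 1))"
    unfolding balanced_def of_nat_eq_iff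
    using points_bounds(2,3) odd_run_split run by (simp add: nat_le_iff)
  moreover have "(tiling_colour A n, tiling_colour A (n + 1),
      tiling_colour (insert n A) n, tiling_colour (insert n A) (n + 1)) =
    tetra (left_sum A n mod 5, right_sum A (n + 1) mod 5, splitting (n + 1), splitting n,
      odd_run A (n + 1), ?x A n, ?x A (n + 1), ?x (insert n A) n, ?x (insert n A) (n + 1))"
    by (simp add: tiling_colour_def tetra_def left_sum_split right_sum_split odd_run_split run
        partner_def mod_add_left_eq)
  ultimately show ?thesis unfolding tiles_def by (intro image_eqI) auto
qed

end

interpretation golden_tiling: tiling tiling_colour
proof
  fix A :: "int set" and n :: int
  assume A: "finite A"
  show "(tiling_colour A n, tiling_colour A (n + 1), tiling_colour (toggle n A) n,
      tiling_colour (toggle n A) (n + 1)) \<in> completion tiles"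
  proof (cases "n \<in> A")
    case True
    \<comment> \<open>With lamp \<open>n\<close> lit, the tetrahedron is the switch of the one seen
      from \<open>A - {n}\<close>.\<close>
    then have "insert n (A - {n}) = A" by auto
    with True show ?thesis
      using tiling_colour_tiles[of "A - {n}" n] A by (simp add: completion_def toggle_def)
  next
    case False
    then show ?thesis using tiling_colour_tiles[of A n] A by (simp add: completion_def toggle_def)
  qed
qed

section \<open>Vertices of the lamplighter group\<close>

text \<open>Lamp \<open>i\<close> sits at \<open>i + 1/2\<close>, so that \<open>gen_b\<close>
  toggles lamp \<open>n\<close> when leaving level \<open>n\<close>.\<close>

definition vertex :: "int set \<Rightarrow> int \<Rightarrow> lamp"
  where "vertex A n = (\<lambda>e. if \<exists>i\<in>A. e = of_int i + 1 / 2 then 1 else 0, n)"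

definition lamps :: "lamp \<Rightarrow> int set"
  where "lamps v = {i. fst v (of_int i + 1 / 2) \<noteq> 0}"

lemma lamps_vertex [simp]: "lamps (vertex A n) = A"
  by (simp add: lamps_def vertex_def)

lemma snd_vertex [simp]: "snd (vertex A n) = n"
  by (simp add: vertex_def)

lemma vertex_lamps:
  assumes "v \<in> carrier lamplighter"
  shows "finite (lamps v)" "vertex (lamps v) (snd v) = v"
proof -
  have v: "{e. fst v e \<noteq> 0} \<subseteq> half_integers" "finite {e. fst v e \<noteq> 0}"
    using assms by (auto simp: lamplighter_def lamp_configs_def)
  have "(\<lambda>i. of_int i + 1 / 2) ` lamps v \<subseteq> {e. fst v e \<noteq> 0}" by (auto simp: lamps_def)
  then have "finite ((\<lambda>i. of_int i + 1 / 2 :: rat) ` lamps v)" using v(2) finite_subset by blast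
  then show "finite (lamps v)" by (rule finite_imageD) (simp add: inj_on_def)
  have "(if \<exists>i\<in>lamps v. e = of_int i + 1 / 2 then 1 else 0) = fst v e" for e
  proof (cases "fst v e = 0")
    case True
    then show ?thesis by (auto simp: lamps_def)
  next
    case False
    then obtain i where "e = of_int i + 1 / 2" using v(1) by (auto simp: half_integers_def)
    with False show ?thesis by (auto simp: lamps_def)
  qed
  then show "vertex (lamps v) (snd v) = v" by (simp add: vertex_def)
qed

lemma vertex_carrier [simp]:
  assumes "finite A"
  shows "vertex A n \<in> carrier lamplighter"
proof -
  have eq: "{e::rat. (if \<exists>i\<in>A. e = of_int i + 1 / 2 then 1 else 0 :: bit) \<noteq> 0} =
    (\<lambda>i. of_int i + 1 / 2) ` A" by auto
  have "finite ((\<lambda>i. of_int i + 1 / 2 :: rat) ` A)" using assms by simp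
  moreover have "(\<lambda>i. of_int i + 1 / 2) ` A \<subseteq> half_integers" by (auto simp: half_integers_def)
  ultimately have "fst (vertex A n) \<in> lamp_configs"
    unfolding lamp_configs_def vertex_def fst_conv mem_Collect_eq eq by simp
  then show ?thesis by (simp add: lamplighter_def vertex_def)
qed

lemma one_vertex: "\<one>\<^bsub>lamplighter\<^esub> = vertex {} 0"
  by (simp add: vertex_def lamplighter_def)

lemma snd_mult: "snd (v \<otimes>\<^bsub>lamplighter\<^esub> w) = snd v + snd w"
  by (simp add: lamplighter_def split_beta)

lemma vertex_mult_lamps: "vertex {} m \<otimes>\<^bsub>lamplighter\<^esub> vertex S 0 = vertex S m"
  by (auto simp: vertex_def lamplighter_def fun_eq_iff)

lemma gen_a_mult: "gen_a \<otimes>\<^bsub>lamplighter\<^esub> vertex A n = vertex A (n + 1)"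
  by (auto simp: gen_a_def vertex_def lamplighter_def fun_eq_iff)

lemma gen_b_mult: "gen_b \<otimes>\<^bsub>lamplighter\<^esub> vertex A n = vertex (toggle n A) (n + 1)"
proof -
  have "(if \<exists>i\<in>A. e = of_int i + 1 / 2 then 1 else 0) + (if e - of_int n = 1 / 2 then 1 else 0) =
    (if \<exists>i\<in>toggle n A. e = of_int i + 1 / 2 then 1 else (0 :: bit))" for e :: rat
  proof (cases "e = of_int n + 1 / 2")
    case True
    then have "(\<exists>i\<in>A. e = of_int i + 1 / 2) \<longleftrightarrow> n \<in> A"
      "(\<exists>i\<in>toggle n A. e = of_int i + 1 / 2) \<longleftrightarrow> n \<notin> A" by (auto simp: mem_toggle)
    moreover have "e - of_int n = 1 / 2" using True by simp
    ultimately show ?thesis by simp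
  next
    case False
    then have "(\<exists>i\<in>toggle n A. e = of_int i + 1 / 2) \<longleftrightarrow> (\<exists>i\<in>A. e = of_int i + 1 / 2)"
      by (auto simp: mem_toggle)
    moreover have "e - of_int n \<noteq> 1 / 2" using False by linarith
    ultimately show ?thesis by simp
  qed
  then show ?thesis
    by (simp add: gen_b_def vertex_def lamplighter_def fun_eq_iff del: add_bit_eq_xor)
qed

lemma inv_gen_b_gen_a_mult:
  assumes "finite A"
  shows "inv\<^bsub>lamplighter\<^esub> gen_b \<otimes>\<^bsub>lamplighter\<^esub> gen_a \<otimes>\<^bsub>lamplighter\<^esub> vertex A n = vertex (toggle n A) n"
proof -
  have "gen_b \<otimes>\<^bsub>lamplighter\<^esub> vertex (toggle n A) n = gen_a \<otimes>\<^bsub>lamplighter\<^esub> vertex A n"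
    by (simp add: gen_a_mult gen_b_mult)
  then have "inv\<^bsub>lamplighter\<^esub> gen_b \<otimes>\<^bsub>lamplighter\<^esub> (gen_a \<otimes>\<^bsub>lamplighter\<^esub> vertex A n) =
    vertex (toggle n A) n"
    using assms by (metis finite_toggle gen_b_closed lamplighter.inv_solve_left vertex_carrier
        lamplighter.m_closed)
  then show ?thesis using assms by (simp add: lamplighter.m_assoc)
qed

lemma tetra_SFT_iff:
  "x \<in> tetra_SFT C \<Delta> \<longleftrightarrow> x \<in> colourings C \<and>
    (\<forall>A n. finite A \<longrightarrow> (x (vertex A n), x (vertex A (n + 1)), x (vertex (toggle n A) n),
      x (vertex (toggle n A) (n + 1))) \<in> completion \<Delta>)" (is "_ \<longleftrightarrow> _ \<and> ?local")
proof -
  have "(\<forall>v\<in>carrier lamplighter. P v) \<longleftrightarrow> (\<forall>A n. finite A \<longrightarrow> P (vertex A n))" for P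
    using vertex_lamps vertex_carrier by metis
  then show ?thesis
    unfolding tetra_SFT_def by (simp add: gen_a_mult gen_b_mult inv_gen_b_gen_a_mult)
qed

text \<open>A stabilizing element that changes levels may carry arbitrary lamps, hence the
  quantifier over \<open>A\<close> in \<open>level\<close>. Otherwise it is a pure lamp pattern
  \<open>S\<close>, moving \<open>vertex {} n\<close> to \<open>vertex S n\<close>.\<close>

lemma stabilizer_trivialI:
  assumes "x \<in> colourings C"
    and lamps: "\<And>S. finite S \<Longrightarrow> S \<noteq> {} \<Longrightarrow> \<exists>n. x (vertex S n) \<noteq> x (vertex {} n)"
    and level: "\<And>k. k \<noteq> 0 \<Longrightarrow> \<exists>n. \<forall>A. finite A \<longrightarrow> x (vertex A (n + k)) \<noteq> x (vertex {} n)"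
  shows "stabilizer lamplighter (shift C) x = {\<one>\<^bsub>lamplighter\<^esub>}"
proof
  show "{\<one>\<^bsub>lamplighter\<^esub>} \<subseteq> stabilizer lamplighter (shift C) x"
    using assms(1) by (simp add: stabilizer_def shift_one)
  show "stabilizer lamplighter (shift C) x \<subseteq> {\<one>\<^bsub>lamplighter\<^esub>}"
  proof
    fix g assume "g \<in> stabilizer lamplighter (shift C) x"
    then have g: "g \<in> carrier lamplighter" and "shift C g x = x" by (auto simp: stabilizer_def)
    then have x: "x (v \<otimes>\<^bsub>lamplighter\<^esub> g) = x v" if "v \<in> carrier lamplighter" for v
    proof -
      have "shift C g x v = x v" by (simp add: \<open>shift C g x = x\<close>)
      then show ?thesis using that assms(1) by (simp add: shift_def)
    qed
    have "snd g = 0"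
    proof (rule ccontr)
      assume "snd g \<noteq> 0"
      then obtain n where n: "\<And>A. finite A \<Longrightarrow> x (vertex A (n + snd g)) \<noteq> x (vertex {} n)"
        using level by blast
      let ?w = "vertex {} n \<otimes>\<^bsub>lamplighter\<^esub> g"
      have "?w \<in> carrier lamplighter" using g by simp
      from vertex_lamps[OF this] have "finite (lamps ?w)" "vertex (lamps ?w) (n + snd g) = ?w"
        by (simp_all add: snd_mult)
      then show False using n[of "lamps ?w"] x[of "vertex {} n"] by simp
    qed
    then have g_eq: "g = vertex (lamps g) 0" using vertex_lamps(2)[OF g] by simp
    have "x (vertex (lamps g) n) = x (vertex {} n)" for n
      using x[of "vertex {} n"] g_eq vertex_mult_lamps[of n "lamps g"] by simp
    then have "lamps g = {}" using lamps vertex_lamps(1)[OF g] by metis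
    then show "g \<in> {\<one>\<^bsub>lamplighter\<^esub>}" using g_eq by (simp add: one_vertex)
  qed
qed

section \<open>The tileset\<close>

definition encode :: "colour tetrahedron \<Rightarrow> nat tetrahedron"
  where "encode = map_prod to_nat (map_prod to_nat (map_prod to_nat to_nat))"

lemma encode_simp: "encode (c1, c2, c3, c4) = (to_nat c1, to_nat c2, to_nat c3, to_nat c4)"
  by (simp add: encode_def)

lemma completion_encode: "completion (encode ` T) = encode ` completion T"
  unfolding completion_def encode_def by (force simp: image_Un image_iff)

lemma completion_Un: "completion (S \<union> T) = completion S \<union> completion T"
  by (auto simp: completion_def)

lemma encode_eqD:
  "(x1, x2, x3, x4) = encode t \<Longrightarrow> (from_nat x1, from_nat x2, from_nat x3, from_nat x4) = t"
  by (cases t) (simp add: encode_simp)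

text \<open>
  These tetrahedra prescribe the colour \<open>N + 1 + i\<close> above a vertex, which no tetrahedron
  allows below: they never occur and only pad the tileset to the required size.
\<close>

definition padding :: "nat \<Rightarrow> nat \<Rightarrow> nat tetrahedron set"
  where "padding N m = (\<lambda>i. (N, N + 1 + i, N, N + 1 + i)) ` {..<m}"

lemma completion_padding: "completion (padding N m) = padding N m"
  by (auto simp: completion_def padding_def)

lemma card_padding: "card (padding N m) = m"
  unfolding padding_def by (subst card_image) (auto simp: inj_on_def)

lemma encoded_tiles_less:
  obtains N where "\<And>x1 x2 x3 x4. (x1, x2, x3, x4) \<in> completion (encode ` tiles) \<Longrightarrow>
    x1 < N \<and> x2 < N \<and> x3 < N \<and> x4 < N"
proof -
  define T where "T = encode ` tiles"
  define U where "U = (\<Union>(x1, x2, x3, x4)\<in>T. {x1, x2, x3, x4})"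
  have "finite U" using finite_tiles by (auto simp: U_def T_def split: prod.split)
  then obtain N where N: "\<forall>x\<in>U. x < N"
    unfolding finite_nat_set_iff_bounded by blast
  show ?thesis
  proof (rule that[of N])
    fix x1 x2 x3 x4 assume "(x1, x2, x3, x4) \<in> completion (encode ` tiles)"
    then have "(x1, x2, x3, x4) \<in> T \<or> (x3, x4, x1, x2) \<in> T"
      by (auto simp: completion_def T_def)
    then have "{x1, x2, x3, x4} \<subseteq> U" unfolding U_def by (elim disjE) fastforce+
    then show "x1 < N \<and> x2 < N \<and> x3 < N \<and> x4 < N" using N by simp
  qed
qed

theorem theorem4p8:
  shows "\<exists>(C :: nat set) \<Delta>.
    finite C \<and> \<Delta> \<subseteq> C \<times> C \<times> C \<times> C \<and> card \<Delta> = 1488 \<and>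
    tetra_SFT C \<Delta> \<noteq> {} \<and>
    (\<forall>x \<in> tetra_SFT C \<Delta>. stabilizer lamplighter (shift C) x = {\<one>\<^bsub>lamplighter\<^esub>})"
proof -
  obtain N where N: "\<And>x1 x2 x3 x4. (x1, x2, x3, x4) \<in> completion (encode ` tiles) \<Longrightarrow>
    x1 < N \<and> x2 < N \<and> x3 < N \<and> x4 < N" using encoded_tiles_less by metis
  define m where "m = 1488 - card (encode ` tiles)"
  \<comment> \<open>Padding colours reach at most \<open>N + m\<close>, and \<open>m\<close> is at
    most 1488.\<close>
  define C where "C = {..N + 1488}"
  define \<Delta> where "\<Delta> = encode ` tiles \<union> padding N m"
  have compl: "completion \<Delta> = completion (encode ` tiles) \<union> padding N m"
    by (simp add: \<Delta>_def completion_Un completion_padding)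
  have sub: "encode ` tiles \<subseteq> completion (encode ` tiles)" by (simp add: completion_def)
  have "card (encode ` tiles) \<le> 1488"
    using card_image_le[OF finite_tiles, of encode] card_tiles by simp
  moreover have "card \<Delta> = card (encode ` tiles) + card (padding N m)"
    unfolding \<Delta>_def
  proof (rule card_Un_disjoint)
    show "encode ` tiles \<inter> padding N m = {}"
      using N sub by (fastforce simp: padding_def)
  qed (use finite_tiles in \<open>simp_all add: padding_def\<close>)
  ultimately have "card \<Delta> = 1488" by (simp add: card_padding m_def)
  moreover have "\<Delta> \<subseteq> C \<times> C \<times> C \<times> C"
  proof -
    have "encode ` tiles \<subseteq> C \<times> C \<times> C \<times> C"
      using N sub by (fastforce simp: C_def dest: less_imp_le_nat)
    moreover have "padding N m \<subseteq> C \<times> C \<times> C \<times> C" by (auto simp: padding_def C_def m_def)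
    ultimately show ?thesis by (simp add: \<Delta>_def)
  qed
  moreover have "tetra_SFT C \<Delta> \<noteq> {}"
  proof -
    define x where "x = (\<lambda>v\<in>carrier lamplighter. to_nat (tiling_colour (lamps v) (snd v)))"
    have x: "x (vertex A n) = to_nat (tiling_colour A n)" if "finite A" for A n
      using that by (simp add: x_def)
    have loc: "(x (vertex A n), x (vertex A (n + 1)), x (vertex (toggle n A) n),
        x (vertex (toggle n A) (n + 1))) \<in> completion (encode ` tiles)" if "finite A" for A n
      using imageI[OF golden_tiling.tile[OF that, of n], of encode] that
      by (simp add: completion_encode x encode_simp)
    have "x v \<in> C" if "v \<in> carrier lamplighter" for v
      using N[OF loc[OF vertex_lamps(1)[OF that], of "snd v"]]
      by (simp add: C_def vertex_lamps(2)[OF that])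
    then have "x \<in> colourings C" by (auto simp: colourings_def x_def)
    then have "x \<in> tetra_SFT C \<Delta>" using loc by (auto simp: tetra_SFT_iff compl)
    then show ?thesis by blast
  qed
  moreover have "stabilizer lamplighter (shift C) x = {\<one>\<^bsub>lamplighter\<^esub>}"
    if "x \<in> tetra_SFT C \<Delta>" for x
  proof -
    have col: "x \<in> colourings C"
      and loc: "finite A \<Longrightarrow> (x (vertex A n), x (vertex A (n + 1)), x (vertex (toggle n A) n),
        x (vertex (toggle n A) (n + 1))) \<in> completion \<Delta>" for A n
      using that by (auto simp: tetra_SFT_iff)
    define f where "f A n = (from_nat (x (vertex A n)) :: colour)" for A n
    interpret tiling f
    proof
      fix A :: "int set" and n :: int
      assume A: "finite A"
      \<comment> \<open>The first entry of every completed tetrahedron is at most \<open>N\<close>;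
        applied one level up, this rules out padding, whose second entry exceeds
        \<open>N\<close>.\<close>
      have below: "x (vertex A n) \<le> N" for n
        using loc[OF A, of n] N by (fastforce simp: compl padding_def)
      have "(x (vertex A n), x (vertex A (n + 1)), x (vertex (toggle n A) n),
          x (vertex (toggle n A) (n + 1))) \<notin> padding N m"
        using below[of "n + 1"] by (auto simp: padding_def)
      then obtain t where "t \<in> completion tiles" "(x (vertex A n), x (vertex A (n + 1)),
          x (vertex (toggle n A) n), x (vertex (toggle n A) (n + 1))) = encode t"
        using loc[OF A, of n] by (auto simp: compl completion_encode)
      then show "(f A n, f A (n + 1), f (toggle n A) n, f (toggle n A) (n + 1)) \<in> completion tiles"
        unfolding f_def by (simp add: encode_eqD)
    qed
    show ?thesis
    proof (rule stabilizer_trivialI[OF col])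
      show "\<exists>n. x (vertex S n) \<noteq> x (vertex {} n)" if "finite S" "S \<noteq> {}" for S
        using lamps_not_period[OF that] unfolding f_def by metis
      show "\<exists>n. \<forall>A. finite A \<longrightarrow> x (vertex A (n + k)) \<noteq> x (vertex {} n)" if "k \<noteq> 0" for k
      proof -
        have "0 < nat \<bar>k\<bar>" using that by simp
        from level_divides_not_periodic[OF this] obtain n
          where "level_divides (n + int (nat \<bar>k\<bar>)) \<noteq> level_divides n" by blast
        \<comment> \<open>For negative \<open>k\<close> the two levels exchange their roles.\<close>
        then have "level_divides ((if 0 < k then n else n - k) + k) \<noteq>
            level_divides (if 0 < k then n else n - k)"
          by (cases "0 < k") auto
        then obtain n' where n': "level_divides (n' + k) \<noteq> level_divides n'" by blast
        have "x (vertex A (n' + k)) \<noteq> x (vertex {} n')" if "finite A" for A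
          using divides_eq_level[OF that, of "n' + k"] n' by (auto simp: f_def level_divides_def)
        then show ?thesis by blast
      qed
    qed
  qed
  ultimately show ?thesis by (intro exI[of _ C] exI[of _ \<Delta>]) (simp add: C_def)
qed

end
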